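(* Let $C_{w,f}$ be a weighted composition operator on $C_0(\Omega)$, and let $\mathfrak{X}$ be the closed subspace of $C_0(\Omega)$ generated by (i.e. the closed linear span of) the functions $\varphi \in C_0(\Omega)$ whose support is contained in a relatively compact open set $B$ in $\Omega$ satisfying \[ \liminf_{N \to \infty} \frac{1}{N} \sum_{n=1}^N \|w^{(n)}\|_{f^{-n}(B)} = 0. \] Then the following assertions are equivalent: (i) $C_{w,f}$ is mean Li-Yorke chaotic; (ii) there exists a sequence $(B_i)_{i \in \mathbb{N}}$ of relatively compact open sets in $\Omega$ such that \[ \overline{B_i} \subset B_{i+1} \quad \text{for all } i \in \mathbb{N}, \] \[ \liminf_{N \to \infty} \frac{1}{N} \sum_{n=1}^N \|w^{(n)}\|_{f^{-n}(B_i)} = 0 \quad \text{for all } i \in \mathbb{N} \] and \[ \sup\Big\{\frac{1}{N} \sum_{n=1}^N \|w^{(n)}\|_{f^{-n}(B_i)} : i, N \in \mathbb{N}\Big\} = \infty; \] (iii) $C_{w,f}$ is not absolutely Cesàro bounded in $\mathfrak{X}$.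
   Context: Fix $\mathbb{K} = \mathbb{R}$ or $\mathbb{C}$ and an arbitrary locally compact Hausdorff space $\Omega$. $C_0(\Omega)$ is the Banach space over $\mathbb{K}$ of all continuous maps $\varphi : \Omega \to \mathbb{K}$ vanishing at infinity, with norm $\|\varphi\| = \sup_{x\in\Omega} |\varphi(x)|$. For a bounded map $\varphi : \Omega \to \mathbb{K}$ and $B \subset \Omega$, $\|\varphi\|_B = \sup_{x\in B}|\varphi(x)|$, with $\|\varphi\|_\varnothing = 0$. The support of $\varphi$ is the closure of $\{x : \varphi(x) \ne 0\}$. A weighted composition operator on $C_0(\Omega)$ is the map $C_{w,f}(\varphi) = (\varphi\circ f)\cdot w$, where $w : \Omega \to \mathbb{K}$ is continuous and bounded, $f : \Omega \to \Omega$ is continuous, and the set $\{x \in \Omega : f(x) \in K \text{ and } |w(x)| \ge \varepsilon\}$ is compact for every $\varepsilon > 0$ and every compact $K \subset \Omega$; these conditions make $C_{w,f}$ a well-defined bounded linear operator on $C_0(\Omega)$. Put $w^{(1)} = w$ and $w^{(n)} = (w\circ f^{n-1})\cdots(w\circ f)\cdot w$ for $n \ge 2$; $\mathbb{N} = \{1,2,\ldots\}$. An operator $T$ on a Banach space $Y$ is absolutely Cesàro bounded in a subspace $Z$ of $Y$ if there exists $C \in (0,\infty)$ such that $\sup_{N\in\mathbb{N}} \frac{1}{N}\sum_{n=1}^N \|T^n y\| \le C\|y\|$ for all $y \in Z$. A map $g : M \to M$ on a metric space $(M,d)$ is mean Li-Yorke chaotic if there is an uncountable set $S \subset M$ such that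 for each pair $(x,y)$ of distinct points of $S$: $\liminf_{N\to\infty} \frac{1}{N}\sum_{n=1}^N d(g^n(x),g^n(y)) = 0$ and $\limsup_{N\to\infty} \frac{1}{N}\sum_{n=1}^N d(g^n(x),g^n(y)) > 0$. *)

theory Defs
  imports "HOL-Analysis.Analysis"
begin

text \<open>
  The space \<open>C\<^sub>0\<close> is the subspace of those elements of the library's Banach space
  \<open>'a \<Rightarrow>\<^sub>C 'k\<close> of bounded continuous functions (with the supremum norm) that vanish at
  infinity. The scalar type \<open>'k\<close> stands for \<^typ>\<open>real\<close> or \<^typ>\<open>complex\<close>.
\<close>

definition C0 :: "('a::topological_space \<Rightarrow>\<^sub>C 'k::real_normed_field) set" where
  "C0 = {\<phi>. \<forall>\<epsilon>>0. compact {x. norm (apply_bcontfun \<phi> x) \<ge> \<epsilon>}}"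

text \<open>
  The library makes \<open>'a \<Rightarrow>\<^sub>C 'k\<close> a vector space over \<^typ>\<open>real\<close> only; this is the pointwise
  multiplication by scalars in \<open>'k\<close>.
\<close>

definition scaleC0 :: "'k::real_normed_field \<Rightarrow> ('a::topological_space \<Rightarrow>\<^sub>C 'k) \<Rightarrow> ('a \<Rightarrow>\<^sub>C 'k)" where
  "scaleC0 c \<phi> = Bcontfun (\<lambda>x. c * apply_bcontfun \<phi> x)"

definition sup_norm_on :: "'a set \<Rightarrow> ('a \<Rightarrow> 'k::real_normed_vector) \<Rightarrow> real" where
  "sup_norm_on B \<phi> = (if B = {} then 0 else (SUP x\<in>B. norm (\<phi> x)))"

definition weight_map_pair :: "('a::topological_space \<Rightarrow> 'k::real_normed_field) \<Rightarrow> ('a \<Rightarrow> 'a) \<Rightarrow> bool" where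
  "weight_map_pair w f \<longleftrightarrow>
     continuous_on UNIV w \<and> bounded (range w) \<and> continuous_on UNIV f \<and>
     (\<forall>\<epsilon>>0. \<forall>K. compact K \<longrightarrow> compact {x. f x \<in> K \<and> norm (w x) \<ge> \<epsilon>})"

definition weighted_comp ::
    "('a::topological_space \<Rightarrow> 'k::real_normed_field) \<Rightarrow> ('a \<Rightarrow> 'a) \<Rightarrow> ('a \<Rightarrow>\<^sub>C 'k) \<Rightarrow> ('a \<Rightarrow>\<^sub>C 'k)" where
  "weighted_comp w f \<phi> = Bcontfun (\<lambda>x. apply_bcontfun \<phi> (f x) * w x)"

definition iter_weight :: "('a \<Rightarrow> 'k::real_normed_field) \<Rightarrow> ('a \<Rightarrow> 'a) \<Rightarrow> nat \<Rightarrow> 'a \<Rightarrow> 'k" where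
  "iter_weight w f n x = (\<Prod>i<n. w ((f ^^ i) x))"

text \<open>The value at \<open>N = 0\<close> is \<open>0\<close> and irrelevant: means are only used for \<open>N \<ge> 1\<close> or as \<open>N\<close> tends to infinity.\<close>

definition cesaro_mean :: "(nat \<Rightarrow> real) \<Rightarrow> nat \<Rightarrow> real" where
  "cesaro_mean a N = (\<Sum>n=1..N. a n) / real N"

definition weight_mean :: "('a \<Rightarrow> 'k::real_normed_field) \<Rightarrow> ('a \<Rightarrow> 'a) \<Rightarrow> 'a set \<Rightarrow> nat \<Rightarrow> real" where
  "weight_mean w f B = cesaro_mean (\<lambda>n. sup_norm_on ((f ^^ n) -` B) (iter_weight w f n))"

definition rel_compact_open :: "'a::topological_space set \<Rightarrow> bool" where
  "rel_compact_open B \<longleftrightarrow> open B \<and> compact (closure B)"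

text \<open>
  The closed \<open>'k\<close>-linear span. The closure is taken in \<open>'a \<Rightarrow>\<^sub>C 'k\<close>, which makes no difference
  since \<^const>\<open>C0\<close> is closed there (lemma \<open>closed_C0\<close> below).
\<close>

definition small_support_space ::
    "('a::topological_space \<Rightarrow> 'k::real_normed_field) \<Rightarrow> ('a \<Rightarrow> 'a) \<Rightarrow> ('a \<Rightarrow>\<^sub>C 'k) set" where
  "small_support_space w f =
     closure (module.span scaleC0
       {\<phi> \<in> C0. \<exists>B. rel_compact_open B \<and>
                    closure {x. apply_bcontfun \<phi> x \<noteq> 0} \<subseteq> B \<and>
                    liminf (\<lambda>N. ereal (weight_mean w f B N)) = 0})"

text \<open>The set \<open>M\<close> with the distance of the ambient type is the metric space on which \<open>g\<close> acts.\<close>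

definition mean_li_yorke_chaotic :: "'m::metric_space set \<Rightarrow> ('m \<Rightarrow> 'm) \<Rightarrow> bool" where
  "mean_li_yorke_chaotic M g \<longleftrightarrow>
     (\<exists>S\<subseteq>M. uncountable S \<and>
        (\<forall>x\<in>S. \<forall>y\<in>S. x \<noteq> y \<longrightarrow>
           liminf (\<lambda>N. ereal (cesaro_mean (\<lambda>n. dist ((g ^^ n) x) ((g ^^ n) y)) N)) = 0 \<and>
           limsup (\<lambda>N. ereal (cesaro_mean (\<lambda>n. dist ((g ^^ n) x) ((g ^^ n) y)) N)) > 0))"

definition abs_cesaro_bounded_in :: "'m::real_normed_vector set \<Rightarrow> ('m \<Rightarrow> 'm) \<Rightarrow> bool" where
  "abs_cesaro_bounded_in Z T \<longleftrightarrow>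
     (\<exists>C>0. \<forall>y\<in>Z. (SUP N\<in>{1..}. ereal (cesaro_mean (\<lambda>n. norm ((T ^^ n) y)) N)) \<le> ereal (C * norm y))"

lemma bounded_range_mult:
  fixes g h :: "'a \<Rightarrow> 'k::real_normed_field"
  assumes "bounded (range g)" "bounded (range h)"
  shows "bounded (range (\<lambda>x. g x * h x))"
proof -
  obtain a b where "\<And>x. norm (g x) \<le> a" "\<And>x. norm (h x) \<le> b"
    using assms unfolding bounded_iff by auto
  then have "norm (g x * h x) \<le> a * b" for x
    unfolding norm_mult by (meson mult_mono norm_ge_zero order_trans)
  then show ?thesis
    unfolding bounded_iff by auto
qed

lemma apply_scaleC0 [simp]: "apply_bcontfun (scaleC0 c \<phi>) x = c * apply_bcontfun \<phi> x"
proof -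
  have "bounded (range (\<lambda>x. c * apply_bcontfun \<phi> x))"
    by (intro bounded_range_mult bounded_apply_bcontfun) simp
  then have "(\<lambda>x. c * apply_bcontfun \<phi> x) \<in> bcontfun"
    unfolding bcontfun_def by (auto intro!: continuous_intros)
  then show ?thesis
    by (simp add: scaleC0_def Bcontfun_inverse)
qed

lemma vector_space_scaleC0:
  "vector_space (scaleC0 :: 'k::real_normed_field \<Rightarrow> ('a::topological_space \<Rightarrow>\<^sub>C 'k) \<Rightarrow> _)"
  by unfold_locales (auto intro!: bcontfun_eqI simp: algebra_simps plus_bcontfun.rep_eq)

lemma apply_weighted_comp:
  assumes "weight_map_pair w f"
  shows "apply_bcontfun (weighted_comp w f \<phi>) x = apply_bcontfun \<phi> (f x) * w x"
proof -
  have w: "continuous_on UNIV w" "bounded (range w)" and f: "continuous_on UNIV f"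
    using assms by (auto simp: weight_map_pair_def)
  have "bounded (range (\<lambda>x. apply_bcontfun \<phi> (f x)))"
    by (rule bounded_subset[OF bounded_apply_bcontfun[of \<phi>]]) auto
  then have "bounded (range (\<lambda>x. apply_bcontfun \<phi> (f x) * w x))"
    by (rule bounded_range_mult) (rule w)
  moreover have "continuous_on UNIV (\<lambda>x. apply_bcontfun \<phi> (f x) * w x)"
    by (intro continuous_on_mult w continuous_on_compose2[OF _ f, of UNIV]) auto
  ultimately show ?thesis
    by (simp add: weighted_comp_def Bcontfun_inverse bcontfun_def)
qed

lemma compact_closed_subset: "compact S \<Longrightarrow> closed T \<Longrightarrow> T \<subseteq> S \<Longrightarrow> compact T"
  using compact_Int_closed[of S T] by (simp add: inf.absorb2)

lemma closed_superlevel: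
  fixes \<phi> :: "'a::topological_space \<Rightarrow>\<^sub>C 'k::real_normed_field"
  shows "closed {x. norm (apply_bcontfun \<phi> x) \<ge> \<epsilon>}"
  by (intro closed_Collect_le continuous_intros) auto

lemma weighted_comp_in_C0:
  fixes w :: "'a::topological_space \<Rightarrow> 'k::real_normed_field"
  assumes wf: "weight_map_pair w f" and \<phi>: "\<phi> \<in> C0"
  shows "weighted_comp w f \<phi> \<in> C0"
  unfolding C0_def
proof (intro CollectI allI impI)
  fix \<epsilon> :: real
  assume "\<epsilon> > 0"
  obtain a b where a: "\<And>x. norm (apply_bcontfun \<phi> x) \<le> a" "a > 0"
    and b: "\<And>x. norm (w x) \<le> b" "b > 0"
    using bounded_apply_bcontfun[of \<phi>] wf unfolding weight_map_pair_def bounded_pos by auto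
  define K where "K = {x. norm (apply_bcontfun \<phi> x) \<ge> \<epsilon> / b}"
  have "compact K"
    using \<phi> \<open>\<epsilon> > 0\<close> b(2) unfolding K_def C0_def by simp
  then have "compact {x. f x \<in> K \<and> norm (w x) \<ge> \<epsilon> / a}"
    using wf \<open>\<epsilon> > 0\<close> a(2) unfolding weight_map_pair_def by simp
  moreover have "{x. norm (apply_bcontfun (weighted_comp w f \<phi>) x) \<ge> \<epsilon>}
      \<subseteq> {x. f x \<in> K \<and> norm (w x) \<ge> \<epsilon> / a}"
  proof (intro subsetI CollectI)
    fix x
    assume "x \<in> {x. norm (apply_bcontfun (weighted_comp w f \<phi>) x) \<ge> \<epsilon>}"
    then have *: "\<epsilon> \<le> norm (apply_bcontfun \<phi> (f x)) * norm (w x)"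
      by (simp add: apply_weighted_comp[OF wf] norm_mult)
    have "\<epsilon> \<le> norm (apply_bcontfun \<phi> (f x)) * b"
      using * mult_left_mono[OF b(1)[of x] norm_ge_zero[of "apply_bcontfun \<phi> (f x)"]] by linarith
    moreover have "\<epsilon> \<le> a * norm (w x)"
      using * mult_right_mono[OF a(1)[of "f x"] norm_ge_zero[of "w x"]] by linarith
    ultimately show "f x \<in> K \<and> norm (w x) \<ge> \<epsilon> / a"
      using a(2) b(2) by (simp add: K_def field_simps)
  qed
  ultimately show "compact {x. norm (apply_bcontfun (weighted_comp w f \<phi>) x) \<ge> \<epsilon>}"
    by (rule compact_closed_subset[OF _ closed_superlevel])
qed

lemma closed_C0: "closed (C0 :: ('a::topological_space \<Rightarrow>\<^sub>C 'k::real_normed_field) set)"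
proof -
  have "\<phi> \<in> C0" if \<phi>: "\<phi> \<in> closure C0" for \<phi> :: "'a \<Rightarrow>\<^sub>C 'k"
    unfolding C0_def
  proof (intro CollectI allI impI)
    fix \<epsilon> :: real
    assume "\<epsilon> > 0"
    then obtain \<psi> where \<psi>: "\<psi> \<in> C0" "dist \<psi> \<phi> < \<epsilon> / 2"
      using \<phi> unfolding closure_approachable by (meson half_gt_zero)
    have "compact {x. norm (apply_bcontfun \<psi> x) \<ge> \<epsilon> / 2}"
      using \<psi>(1) \<open>\<epsilon> > 0\<close> half_gt_zero unfolding C0_def by blast
    moreover have "{x. norm (apply_bcontfun \<phi> x) \<ge> \<epsilon>} \<subseteq> {x. norm (apply_bcontfun \<psi> x) \<ge> \<epsilon> / 2}"
    proof (intro subsetI CollectI)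
      fix x
      assume "x \<in> {x. norm (apply_bcontfun \<phi> x) \<ge> \<epsilon>}"
      moreover have "norm (apply_bcontfun \<psi> x - apply_bcontfun \<phi> x) < \<epsilon> / 2"
        using dist_fun_lt_imp_dist_val_lt[OF \<psi>(2), of x] by (simp add: dist_norm)
      ultimately show "norm (apply_bcontfun \<psi> x) \<ge> \<epsilon> / 2"
        using norm_triangle_ineq2[of "apply_bcontfun \<phi> x" "apply_bcontfun \<psi> x"]
        by (simp add: norm_minus_commute)
    qed
    ultimately show "compact {x. norm (apply_bcontfun \<phi> x) \<ge> \<epsilon>}"
      by (rule compact_closed_subset[OF _ closed_superlevel])
  qed
  then show ?thesis
    using closure_subset_eq by blast
qed

end

theory Submission
  imports Defs
begin

text \<open>
  A scrambled set for a linear operator exists as soon as one vector has Cesaro means with limit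
  inferior \<open>0\<close> that do not tend to \<open>0\<close> (semi-irregular): take the real line through it. Absolute Cesaro
  boundedness along the orbit of a vector upgrades limit inferior \<open>0\<close> to limit \<open>0\<close>, so it excludes
  semi-irregular vectors. Conversely, if it fails on the closure of a subspace whose vectors have means
  tending to \<open>0\<close> along a common sequence of times, then a Baire category argument gives a vector
  whose means have limit inferior \<open>0\<close> and are unbounded (irregular). The generators of the closed
  span in the theorem have means with limit inferior \<open>0\<close>, but along sequences of times depending on
  the generator; either one of them is semi-irregular, or all their means tend to \<open>0\<close>, and the
  previous argument applies in both cases. The superlevel sets of an irregular function form the required
  sequence of open sets, and Urysohn functions lead from such a sequence back to unboundedness.
\<close>

section \<open>Limits inferior and superior of nonnegative sequences\<close>

lemma liminf_ereal_eq_0_iff: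
  fixes u :: "nat \<Rightarrow> real"
  assumes "\<And>n. 0 \<le> u n"
  shows "liminf (\<lambda>n. ereal (u n)) = 0 \<longleftrightarrow> (\<forall>\<epsilon>>0. \<forall>m. \<exists>n\<ge>m. u n < \<epsilon>)"
proof -
  have *: "0 \<le> liminf (\<lambda>n. ereal (u n))"
    by (intro Liminf_bounded) (simp add: assms)
  have "liminf (\<lambda>n. ereal (u n)) \<le> 0" if h: "\<forall>\<epsilon>>0. \<forall>m. \<exists>n\<ge>m. u n < \<epsilon>"
  proof (rule ccontr)
    assume "\<not> liminf (\<lambda>n. ereal (u n)) \<le> 0"
    then obtain e where e: "0 < ereal e" "ereal e < liminf (\<lambda>n. ereal (u n))"
      using ereal_dense2[of 0 "liminf (\<lambda>n. ereal (u n))"] by (auto simp: not_le)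
    from less_LiminfD[OF e(2)] obtain m where "\<forall>n\<ge>m. e < u n"
      by (auto simp: eventually_sequentially)
    with h e(1) show False by (force dest: less_asym)
  qed
  moreover have "\<exists>n\<ge>m. u n < e"
    if "liminf (\<lambda>n. ereal (u n)) = 0" "e > 0" for e m
  proof (rule ccontr)
    assume "\<not> (\<exists>n\<ge>m. u n < e)"
    then have "\<forall>\<^sub>F n in sequentially. ereal e \<le> ereal (u n)"
      by (auto simp: eventually_sequentially not_less intro!: exI[of _ m])
    then have "ereal e \<le> liminf (\<lambda>n. ereal (u n))"
      by (rule Liminf_bounded)
    with that show False by simp
  qed
  ultimately show ?thesis
    using * by (metis antisym)
qed

text \<open>The indices at which \<open>v\<close> is small serve for \<open>u\<close> as well. This
  one lemma carries limit inferior 0 back and forth between orbit means and weight means.\<close>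

lemma liminf_eq_0_mono:
  fixes u v :: "nat \<Rightarrow> real"
  assumes u: "\<And>n. 0 \<le> u n" and v0: "\<And>n. 0 \<le> v n" and v: "\<And>n. u n \<le> c * v n"
    and lim: "liminf (\<lambda>n. ereal (v n)) = 0"
  shows "liminf (\<lambda>n. ereal (u n)) = 0"
proof -
  have *: "\<exists>n\<ge>m. u n < e" if "e > 0" for e m
  proof -
    \<comment> \<open>\<open>c\<close> may be 0 (for instance the norm of a zero function);
      enlarging it to a positive \<open>K\<close> allows division and keeps the bound because
      \<open>v\<close> is nonnegative.\<close>
    define K where "K = \<bar>c\<bar> + 1"
    have K: "K > 0" "c \<le> K" by (auto simp: K_def)
    then have "e / K > 0" using \<open>e > 0\<close> by simp
    then obtain n where n: "n \<ge> m" "v n < e / K"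
      using lim v0 unfolding liminf_ereal_eq_0_iff[of v, OF v0] by blast
    have "u n \<le> K * v n"
      using v[of n] mult_right_mono[OF K(2) v0[of n]] by linarith
    also have "\<dots> < e" using n(2) K(1) by (simp add: field_simps)
    finally show ?thesis using n(1) by blast
  qed
  then show ?thesis by (simp add: liminf_ereal_eq_0_iff u)
qed

text \<open>A limit superior of at most 0 puts the terms eventually below every positive bound,
  which for nonnegative terms is convergence to 0. The second condition for chaos thus becomes
  failure of convergence.\<close>

lemma limsup_ereal_pos_iff:
  fixes u :: "nat \<Rightarrow> real"
  assumes "\<And>n. 0 \<le> u n"
  shows "limsup (\<lambda>n. ereal (u n)) > 0 \<longleftrightarrow> \<not> u \<longlonglongrightarrow> 0"
proof -
  have "limsup (\<lambda>n. ereal (u n)) \<le> 0 \<longleftrightarrow> (\<forall>e>0. \<forall>\<^sub>F n in sequentially. u n < e)"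
  proof -
    have "(\<forall>e>0. \<forall>\<^sub>F n in sequentially. u n < e) \<longleftrightarrow>
        (\<forall>e>0. \<forall>\<^sub>F n in sequentially. ereal (u n) < e)"
    proof (intro iffI allI impI)
      fix e :: ereal
      assume h: "\<forall>e>0. \<forall>\<^sub>F n in sequentially. u n < e" and "e > 0"
      then show "\<forall>\<^sub>F n in sequentially. ereal (u n) < e"
        by (cases e) auto
    next
      fix e :: real
      assume h: "\<forall>e>0. \<forall>\<^sub>F n in sequentially. ereal (u n) < e" and "e > 0"
      then show "\<forall>\<^sub>F n in sequentially. u n < e"
        using h[rule_format, of "ereal e"] by simp
    qed
    then show ?thesis
      by (simp add: Limsup_le_iff)
  qed
  also have "\<dots> \<longleftrightarrow> u \<longlonglongrightarrow> 0"
    using assms by (simp add: tendsto_iff)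
  finally show ?thesis by (simp add: not_le[symmetric])
qed

subsection \<open>Cesaro means along orbits\<close>

definition orbit_mean :: "('b::real_normed_vector \<Rightarrow> 'b) \<Rightarrow> 'b \<Rightarrow> nat \<Rightarrow> real" where
  "orbit_mean T y = cesaro_mean (\<lambda>n. norm ((T ^^ n) y))"

lemma cesaro_mean_nonneg: "(\<And>n. 0 \<le> a n) \<Longrightarrow> 0 \<le> cesaro_mean a N"
  by (simp add: cesaro_mean_def sum_nonneg)

lemma cesaro_mean_mono: "(\<And>n. 1 \<le> n \<Longrightarrow> a n \<le> b n) \<Longrightarrow> cesaro_mean a N \<le> cesaro_mean b N"
  by (auto simp: cesaro_mean_def intro!: divide_right_mono sum_mono)

lemma cesaro_mean_add: "cesaro_mean (\<lambda>n. a n + b n) N = cesaro_mean a N + cesaro_mean b N"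
  by (simp add: cesaro_mean_def sum.distrib add_divide_distrib)

lemma cesaro_mean_cmult: "cesaro_mean (\<lambda>n. c * a n) N = c * cesaro_mean a N"
  by (simp add: cesaro_mean_def sum_distrib_left)

lemma orbit_mean_nonneg [simp]: "0 \<le> orbit_mean T y N"
  by (simp add: orbit_mean_def cesaro_mean_nonneg)

lemma abs_cesaro_bounded_in_iff:
  "abs_cesaro_bounded_in Z T \<longleftrightarrow> (\<exists>C>0. \<forall>y\<in>Z. \<forall>N\<ge>1. orbit_mean T y N \<le> C * norm y)"
  by (simp add: abs_cesaro_bounded_in_def orbit_mean_def SUP_le_iff Ball_def)

lemma abs_cesaro_bounded_in_subset:
  "abs_cesaro_bounded_in Z T \<Longrightarrow> Y \<subseteq> Z \<Longrightarrow> abs_cesaro_bounded_in Y T"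
  unfolding abs_cesaro_bounded_in_iff by blast

text \<open>One small mean forces one iterate \<open>(T ^^ j) y\<close> to be small. The uniform
  bound applied to that iterate controls all means of its orbit, and the first \<open>j\<close>
  terms of the orbit of \<open>y\<close> disappear in the average.\<close>

lemma abs_cesaro_bounded_imp_mean_tendsto_0:
  assumes acb: "abs_cesaro_bounded_in Z T"
    and orbit: "\<And>n. (T ^^ n) y \<in> Z"
    and inf: "liminf (\<lambda>N. ereal (orbit_mean T y N)) = 0"
  shows "orbit_mean T y \<longlonglongrightarrow> 0"
proof -
  obtain C where C: "C > 0" "\<And>z N. z \<in> Z \<Longrightarrow> N \<ge> 1 \<Longrightarrow> orbit_mean T z N \<le> C * norm z"
    using acb unfolding abs_cesaro_bounded_in_iff by blast
  have "\<forall>\<^sub>F N in sequentially. orbit_mean T y N < e" if "e > 0" for e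
  proof -
    define d where "d = e / (2 * C)"
    have "d > 0" using \<open>e > 0\<close> C by (simp add: d_def)
    with inf obtain M where M: "M \<ge> 1" "orbit_mean T y M < d"
      by (subst (asm) liminf_ereal_eq_0_iff) auto
    \<comment> \<open>If all iterates had norm at least \<open>d\<close>, so would the mean at
      \<open>M\<close>; here \<open>M \<ge> 1\<close> matters, since the mean at 0 is 0 by
      default.\<close>
    have "\<exists>j. norm ((T ^^ j) y) < d"
    proof (rule ccontr)
      assume "\<not> ?thesis"
      then have "cesaro_mean (\<lambda>_. d) M \<le> orbit_mean T y M"
        unfolding orbit_mean_def by (intro cesaro_mean_mono) (simp add: not_less)
      with M show False by (simp add: cesaro_mean_def)
    qed
    then obtain j where j: "norm ((T ^^ j) y) < d" ..
    define A where "A = (\<Sum>n=1..j. norm ((T ^^ n) y))"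
    have bound: "orbit_mean T y N \<le> A / real N + e / 2" if "N \<ge> 1" for N
    proof -
      \<comment> \<open>Adding \<open>j\<close> terms leaves, after the first \<open>j\<close>,
        exactly \<open>N\<close> terms: the sum for the orbit of \<open>(T ^^ j) y\<close>.\<close>
      have "(\<Sum>n=1..N. norm ((T ^^ n) y)) \<le> (\<Sum>n=1..N+j. norm ((T ^^ n) y))"
        by (intro sum_mono2) auto
      also have "\<dots> = A + (\<Sum>n=j+1..j+N. norm ((T ^^ n) y))"
        unfolding A_def by (subst add.commute) (rule sum.ub_add_nat, simp)
      also have "(\<Sum>n=j+1..j+N. norm ((T ^^ n) y)) = (\<Sum>n=1..N. norm ((T ^^ n) ((T ^^ j) y)))"
        using sum.shift_bounds_cl_nat_ivl[of "\<lambda>n. norm ((T ^^ n) y)" 1 j N]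
        by (simp add: funpow_add add.commute)
      finally have "orbit_mean T y N \<le> A / real N + orbit_mean T ((T ^^ j) y) N"
        unfolding orbit_mean_def cesaro_mean_def add_divide_distrib[symmetric]
        by (intro divide_right_mono) auto
      also have "orbit_mean T ((T ^^ j) y) N \<le> C * d"
        using C(2)[OF orbit[of j] that] j C(1) by (meson less_imp_le mult_left_mono order_trans)
      also have "C * d = e / 2" using C by (simp add: d_def)
      finally show ?thesis by simp
    qed
    have "(\<lambda>N. A / real N) \<longlonglongrightarrow> 0"
      by (rule lim_const_over_n)
    then have "\<forall>\<^sub>F N in sequentially. A / real N < e / 2"
      using \<open>e > 0\<close> by (intro order_tendstoD) auto
    then show ?thesis
      using eventually_ge_at_top[of 1]
    proof eventually_elim
      case (elim N)
      show ?case using bound[OF elim(2)] elim(1) by linarith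
    qed
  qed
  then show ?thesis by (simp add: tendsto_iff)
qed

section \<open>Orbit means of a bounded linear operator\<close>

lemma bounded_linear_funpow:
  fixes T :: "'b::real_normed_vector \<Rightarrow> 'b"
  assumes "bounded_linear T"
  shows "bounded_linear (T ^^ n)"
proof (induction n)
  case 0
  show ?case using bounded_linear_ident by (simp add: id_def)
next
  case (Suc n)
  then show ?case
    using bounded_linear_compose[OF assms Suc] by (simp add: o_def)
qed

context
  fixes T :: "'b::real_normed_vector \<Rightarrow> 'b"
  assumes T: "bounded_linear T"
begin

lemma orbit_mean_add_le: "orbit_mean T (x + y) N \<le> orbit_mean T x N + orbit_mean T y N"
proof -
  interpret Tn: bounded_linear "T ^^ n" for n
    using T by (rule bounded_linear_funpow)
  show ?thesis
    unfolding orbit_mean_def cesaro_mean_add[symmetric]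
    by (intro cesaro_mean_mono) (simp add: Tn.add norm_triangle_ineq)
qed

lemma orbit_mean_scaleR: "orbit_mean T (c *\<^sub>R y) N = \<bar>c\<bar> * orbit_mean T y N"
proof -
  interpret Tn: bounded_linear "T ^^ n" for n
    using T by (rule bounded_linear_funpow)
  show ?thesis
    unfolding orbit_mean_def cesaro_mean_cmult[symmetric] by (simp add: Tn.scaleR)
qed

lemma orbit_mean_minus: "orbit_mean T (- y) N = orbit_mean T y N"
  using orbit_mean_scaleR[of "-1"] by simp

lemma orbit_mean_0: "orbit_mean T 0 N = 0"
  using orbit_mean_scaleR[of 0 0] by simp

text \<open>Makes the conditions in the Baire category argument open.\<close>

lemma continuous_on_orbit_mean: "continuous_on A (\<lambda>y. orbit_mean T y N)"
  unfolding orbit_mean_def cesaro_mean_def divide_inverse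
  by (intro continuous_intros bounded_linear.continuous_on[OF bounded_linear_funpow[OF T]])

lemma orbit_mean_image_le: "orbit_mean T (T y) N \<le> onorm T * orbit_mean T y N"
  unfolding orbit_mean_def cesaro_mean_cmult[symmetric]
  by (intro cesaro_mean_mono) (simp add: funpow_swap1[symmetric] onorm[OF T])

lemma liminf_orbit_mean_image:
  assumes "liminf (\<lambda>N. ereal (orbit_mean T y N)) = 0"
  shows "liminf (\<lambda>N. ereal (orbit_mean T (T y) N)) = 0"
  using orbit_mean_nonneg orbit_mean_nonneg orbit_mean_image_le assms by (rule liminf_eq_0_mono)

lemma dist_funpow: "dist ((T ^^ n) x) ((T ^^ n) y) = norm ((T ^^ n) (x - y))"
  by (simp add: dist_norm linear_diff[OF bounded_linear.linear[OF bounded_linear_funpow[OF T]]])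

text \<open>If \<open>y\<close> is semi-irregular, the line spanned by \<open>y\<close> is already a scrambled set.\<close>

lemma mean_li_yorke_chaotic_iff:
  assumes M: "subspace M"
  shows "mean_li_yorke_chaotic M T \<longleftrightarrow>
    (\<exists>y\<in>M. liminf (\<lambda>N. ereal (orbit_mean T y N)) = 0 \<and> \<not> orbit_mean T y \<longlonglongrightarrow> 0)"
    (is "_ \<longleftrightarrow> (\<exists>y\<in>M. ?semi_irregular y)")
proof
  assume "mean_li_yorke_chaotic M T"
  then obtain S where S: "S \<subseteq> M" "uncountable S"
    "\<And>x y. x \<in> S \<Longrightarrow> y \<in> S \<Longrightarrow> x \<noteq> y \<Longrightarrow> ?semi_irregular (x - y)"
    unfolding mean_li_yorke_chaotic_def dist_funpow orbit_mean_def[symmetric]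
      limsup_ereal_pos_iff[OF orbit_mean_nonneg] by blast
  obtain x where x: "x \<in> S"
    using \<open>uncountable S\<close> by fastforce
  obtain y where y: "y \<in> S" "x \<noteq> y"
    using \<open>uncountable S\<close> countable_subset[of S "{x}"] by auto
  show "\<exists>y\<in>M. ?semi_irregular y"
    using S(3)[OF x y] S(1) x y(1) M by (meson subsetD subspace_diff)
next
  assume "\<exists>y\<in>M. ?semi_irregular y"
  then obtain y where y: "y \<in> M" "?semi_irregular y" by blast
  \<comment> \<open>The means of 0 converge to 0, so \<open>y\<close> is nonzero and its real
    multiples are pairwise distinct.\<close>
  moreover have "orbit_mean T 0 = (\<lambda>_. 0)" by (simp add: fun_eq_iff orbit_mean_0)
  then have "orbit_mean T 0 \<longlonglongrightarrow> 0" by simp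
  ultimately have "y \<noteq> 0" by blast
  define S where "S = range (\<lambda>c::real. c *\<^sub>R y)"
  have "inj (\<lambda>c::real. c *\<^sub>R y)"
    using \<open>y \<noteq> 0\<close> by (auto intro: injI)
  then have "uncountable S"
    unfolding S_def using countable_image_inj_eq uncountable_UNIV_real by blast
  moreover have "?semi_irregular (c *\<^sub>R y - d *\<^sub>R y)" if "c \<noteq> d" for c d
  proof -
    have eq: "orbit_mean T (c *\<^sub>R y - d *\<^sub>R y) = (\<lambda>N. \<bar>c - d\<bar> * orbit_mean T y N)"
      by (simp add: fun_eq_iff orbit_mean_scaleR flip: scaleR_diff_left)
    have "liminf (\<lambda>N. ereal (\<bar>c - d\<bar> * orbit_mean T y N)) = 0"
      by (rule liminf_eq_0_mono[OF _ orbit_mean_nonneg order_refl conjunct1[OF y(2)]]) simp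
    moreover have "\<not> (\<lambda>N. \<bar>c - d\<bar> * orbit_mean T y N) \<longlonglongrightarrow> 0"
      using y(2) tendsto_mult_left_iff[of "\<bar>c - d\<bar>" "orbit_mean T y" 0] that by simp
    ultimately show ?thesis unfolding eq by blast
  qed
  moreover have "S \<subseteq> M"
    using y M by (auto simp: S_def subspace_scale)
  ultimately show "mean_li_yorke_chaotic M T"
    unfolding mean_li_yorke_chaotic_def dist_funpow orbit_mean_def[symmetric]
      limsup_ereal_pos_iff[OF orbit_mean_nonneg]
    by (intro exI[of _ S]) (auto simp: S_def)
qed

lemma liminf_orbit_mean_funpow:
  assumes "liminf (\<lambda>N. ereal (orbit_mean T y N)) = 0"
  shows "liminf (\<lambda>N. ereal (orbit_mean T ((T ^^ j) y) N)) = 0"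
  by (induction j) (simp_all add: assms liminf_orbit_mean_image)

end

section \<open>Irregular vectors by Baire category\<close>

lemma tendsto_0_le_nonneg:
  fixes u v :: "nat \<Rightarrow> real"
  assumes "v \<longlonglongrightarrow> 0" "\<And>n. 0 \<le> u n" "\<And>n. u n \<le> v n"
  shows "u \<longlonglongrightarrow> 0"
  using assms by (intro tendsto_sandwich[of "\<lambda>_. 0" u _ v]) auto

text \<open>The means are subadditive and absolutely homogeneous at each time. The times
  \<open>r\<close> are left open: all naturals are used when every generator has null means, and a
  null subsequence of the means of one vector otherwise.\<close>

lemma subspace_mean_tendsto_0:
  assumes T: "bounded_linear T" and M: "subspace M"
  shows "subspace {y \<in> M. (\<lambda>k. orbit_mean T y (r k)) \<longlonglongrightarrow> 0}" (is "subspace ?D")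
proof (rule subspaceI)
  show "0 \<in> ?D"
    using M by (simp add: orbit_mean_0[OF T] subspace_0)
  show "x + y \<in> ?D" if "x \<in> ?D" "y \<in> ?D" for x y
  proof -
    have "(\<lambda>k. orbit_mean T x (r k) + orbit_mean T y (r k)) \<longlonglongrightarrow> 0"
      using that tendsto_add_zero by auto
    then have "(\<lambda>k. orbit_mean T (x + y) (r k)) \<longlonglongrightarrow> 0"
      by (rule tendsto_0_le_nonneg) (simp_all add: orbit_mean_add_le[OF T])
    then show ?thesis using that M by (simp add: subspace_add)
  qed
  show "c *\<^sub>R x \<in> ?D" if "x \<in> ?D" for c x
    using that M by (simp add: orbit_mean_scaleR[OF T] subspace_scale tendsto_mult_right_zero)
qed

lemma subspace_closure:
  fixes D :: "'b::real_normed_vector set"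
  assumes "subspace D"
  shows "subspace (closure D)"
proof (rule subspaceI)
  show "0 \<in> closure D"
    using assms closure_subset subspace_0 by blast
  show "x + y \<in> closure D" if xy: "x \<in> closure D" "y \<in> closure D" for x y
  proof -
    obtain u v where "\<And>n. u n \<in> D" "u \<longlonglongrightarrow> x" "\<And>n. v n \<in> D" "v \<longlonglongrightarrow> y"
      using xy unfolding closure_sequential by metis
    then have "\<forall>n. u n + v n \<in> D" "(\<lambda>n. u n + v n) \<longlonglongrightarrow> x + y"
      using assms by (auto intro: subspace_add tendsto_add)
    then show ?thesis
      unfolding closure_sequential by (intro exI conjI)
  qed
  show "c *\<^sub>R x \<in> closure D" if x: "x \<in> closure D" for c x
  proof -
    obtain u where "\<And>n. u n \<in> D" "u \<longlonglongrightarrow> x"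
      using x unfolding closure_sequential by metis
    then have "\<forall>n. c *\<^sub>R u n \<in> D" "(\<lambda>n. c *\<^sub>R u n) \<longlonglongrightarrow> c *\<^sub>R x"
      using assms by (auto intro: subspace_scale tendsto_scaleR)
    then show ?thesis
      unfolding closure_sequential by (intro exI conjI)
  qed
qed

text \<open>On the one hand every point of \<open>D\<close> has small means at times \<open>r k\<close>, on the other hand adding
  or subtracting a vector with a large mean makes some mean large; both are dense open
  conditions, so the Baire category theorem applies.\<close>

lemma exists_mean_irregular_vector:
  fixes T :: "'b::real_normed_vector \<Rightarrow> 'b"
  assumes complete: "complete (UNIV :: 'b set)" and T: "bounded_linear T" and D: "subspace D"
    and r: "filterlim r at_top sequentially"
    and small: "\<And>y. y \<in> D \<Longrightarrow> (\<lambda>k. orbit_mean T y (r k)) \<longlonglongrightarrow> 0"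
    and unbounded: "\<not> abs_cesaro_bounded_in (closure D) T"
  obtains y where "y \<in> closure D" "liminf (\<lambda>N. ereal (orbit_mean T y N)) = 0"
    "\<And>c. \<exists>N\<ge>1. orbit_mean T y N > c"
proof -
  define Y where "Y = closure D"
  have Y: "subspace Y" "closed Y" "D \<subseteq> Y"
    by (auto simp: Y_def subspace_closure D closure_subset)
  \<comment> \<open>Membership in every \<open>U m\<close> gives limit inferior 0, as both the
    lateness of \<open>N\<close> and the bound improve with \<open>m\<close>; membership in every
    \<open>V m\<close> gives unbounded means.\<close>
  define U where "U = (\<lambda>m. Y \<inter> (\<Union>N\<in>{m..}. {y. orbit_mean T y N < 1 / (real m + 1)}))"
  define V where "V = (\<lambda>m::nat. Y \<inter> (\<Union>N\<in>{1..}. {y. orbit_mean T y N > real m}))"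
  have "openin (top_of_set Y) (U m)" for m
    unfolding U_def by (intro openin_open_Int open_UN ballI open_Collect_less
        continuous_on_orbit_mean[OF T] continuous_intros)
  moreover have "openin (top_of_set Y) (V m)" for m
    unfolding V_def by (intro openin_open_Int open_UN ballI open_Collect_less
        continuous_on_orbit_mean[OF T] continuous_intros)
  moreover have "Y \<subseteq> closure (U m)" for m
  proof -
    have "y \<in> U m" if "y \<in> D" for y
    proof -
      have "\<forall>\<^sub>F k in sequentially. orbit_mean T y (r k) < 1 / (real m + 1)"
        using small[OF that] by (rule order_tendstoD) simp
      moreover have "\<forall>\<^sub>F k in sequentially. r k \<ge> m"
        using r by (simp add: filterlim_at_top)
      ultimately have "\<forall>\<^sub>F k in sequentially. y \<in> U m"
        by eventually_elim (use that Y in \<open>auto simp: U_def\<close>)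
      then show ?thesis by simp
    qed
    then show ?thesis unfolding Y_def by (intro closure_mono) auto
  qed
  moreover have "Y \<subseteq> closure (V m)" for m
  proof
    fix y assume "y \<in> Y"
    show "y \<in> closure (V m)"
      unfolding closure_approachable
    proof (intro allI impI)
      fix e :: real assume "e > 0"
      \<comment> \<open>Chosen so that a vector violating the bound \<open>C\<close>, rescaled to
        norm \<open>e / 2\<close>, has a mean above \<open>m + 1\<close>.\<close>
      define C where "C = 2 * (real m + 1) / e"
      have "C > 0" using \<open>e > 0\<close> by (simp add: C_def)
      then obtain z N where z: "z \<in> Y" "N \<ge> 1" "C * norm z < orbit_mean T z N"
        using unbounded unfolding abs_cesaro_bounded_in_iff Y_def by (meson not_less)
      then have "z \<noteq> 0" using orbit_mean_0[OF T] by auto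
      define v where "v = (e / (2 * norm z)) *\<^sub>R z"
      have v: "v \<in> Y" "norm v < e"
        using \<open>z \<noteq> 0\<close> \<open>e > 0\<close> z Y by (auto simp: v_def subspace_scale)
      have "real m < (e / (2 * norm z)) * (C * norm z)"
        using \<open>z \<noteq> 0\<close> \<open>e > 0\<close> by (simp add: C_def)
      also have "\<dots> < orbit_mean T v N"
        using \<open>z \<noteq> 0\<close> \<open>e > 0\<close> z(3) by (simp add: v_def orbit_mean_scaleR[OF T] field_simps)
      finally have "2 * real m < orbit_mean T (2 *\<^sub>R v) N"
        by (simp add: orbit_mean_scaleR[OF T])
      also have "\<dots> = orbit_mean T ((y + v) + - (y - v)) N"
        by (simp add: scaleR_2)
      also have "\<dots> \<le> orbit_mean T (y + v) N + orbit_mean T (y - v) N"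
        using orbit_mean_add_le[OF T, of "y + v" "- (y - v)" N]
        by (simp only: orbit_mean_minus[OF T])
      finally consider "real m < orbit_mean T (y + v) N" | "real m < orbit_mean T (y - v) N"
        by linarith
      then show "\<exists>x\<in>V m. dist x y < e"
      proof cases
        case 1
        then have "y + v \<in> V m" using z v Y \<open>y \<in> Y\<close> by (auto simp: V_def subspace_add)
        then show ?thesis using v by (intro bexI[of _ "y + v"]) (auto simp: dist_norm)
      next
        case 2
        then have "y - v \<in> V m" using z v Y \<open>y \<in> Y\<close> by (auto simp: V_def subspace_diff)
        then show ?thesis using v by (intro bexI[of _ "y - v"]) (auto simp: dist_norm)
      qed
    qed
  qed
  moreover have "U m \<subseteq> Y" "V m \<subseteq> Y" for m
    by (auto simp: U_def V_def)
  ultimately have UV: "\<forall>S\<in>range U \<union> range V. openin (top_of_set Y) S \<and> Y \<subseteq> closure S \<and> S \<subseteq> Y"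
    by (intro ballI) (elim UnE rangeE, simp_all only: simp_thms)
  \<comment> \<open>The category theorem is applied in the subspace topology of \<open>Y\<close>, so
    density is restated with the closure relative to \<open>Y\<close>.\<close>
  have dense: "openin (top_of_set Y) S \<and> top_of_set Y closure_of S = topspace (top_of_set Y)"
    if "S \<in> range U \<union> range V" for S
  proof -
    have "openin (top_of_set Y) S" "Y \<inter> closure S = Y" "Y \<inter> S = S"
      using UV[rule_format, OF that] by (simp_all only: Int_absorb1 Int_absorb2)
    then show ?thesis
      by (simp only: closure_of_subtopology topspace_euclidean_subtopology euclidean_closure_of simp_thms)
  qed
  have "completely_metrizable_space (euclidean :: 'b topology)"
    using Met_TC.completely_metrizable_space_mtopology complete by auto
  moreover have "closedin euclidean Y"
    using Y(2) by simp
  ultimately have metrizable: "completely_metrizable_space (top_of_set Y)"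
    by (rule completely_metrizable_space_closedin)
  have "countable (range U \<union> range V)"
    by simp
  then have "top_of_set Y closure_of \<Inter>(range U \<union> range V) = topspace (top_of_set Y)"
    using dense by (rule Baire_category[OF disjI1[OF metrizable]])
  moreover have "topspace (top_of_set Y) \<noteq> {}"
    using Y(1) subspace_0 by fastforce
  ultimately have "\<Inter>(range U \<union> range V) \<noteq> {}"
    by (metis closure_of_empty)
  then obtain y where "y \<in> \<Inter>(range U \<union> range V)"
    by blast
  then have y: "y \<in> U m" "y \<in> V m" for m
    by blast+
  show thesis
  proof
    show "y \<in> closure D" using y(1)[of 0] by (simp add: U_def Y_def)
    show "liminf (\<lambda>N. ereal (orbit_mean T y N)) = 0"
    proof (subst liminf_ereal_eq_0_iff, simp, intro allI impI)
      fix e :: real and m assume "e > 0"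
      then obtain k where k: "1 / (real k + 1) < e"
        using reals_Archimedean[of e] by (auto simp: inverse_eq_divide add.commute)
      \<comment> \<open>The index \<open>max k m\<close> yields at once a time beyond
        \<open>m\<close> and a mean below \<open>e\<close>.\<close>
      obtain N where N: "N \<ge> max k m" "orbit_mean T y N < 1 / (real (max k m) + 1)"
        using y(1)[of "max k m"] by (auto simp: U_def)
      note N(2)
      also have "1 / (real (max k m) + 1) \<le> 1 / (real k + 1)"
        by (intro divide_left_mono) auto
      also note k
      finally show "\<exists>n\<ge>m. orbit_mean T y n < e" using N(1) by auto
    qed
    show "\<exists>N\<ge>1. orbit_mean T y N > c" for c
    proof -
      obtain m where "c \<le> real m" using real_arch_simple by blast
      then show ?thesis using y(2)[of m] by (force simp: V_def)
    qed
  qed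
qed


text \<open>A semi-irregular vector \<open>y\<close> makes \<open>T\<close> fail to be absolutely Cesaro bounded on the subspace of
  vectors whose means tend to \<open>0\<close> along a common null subsequence of the means of \<open>y\<close>.\<close>

lemma semi_irregular_imp_irregular:
  fixes T :: "'b::real_normed_vector \<Rightarrow> 'b"
  assumes complete: "complete (UNIV :: 'b set)" and T: "bounded_linear T" and M: "subspace M" "closed M" "T ` M \<subseteq> M"
    and y: "y \<in> M" "liminf (\<lambda>N. ereal (orbit_mean T y N)) = 0" "\<not> orbit_mean T y \<longlonglongrightarrow> 0"
  obtains z where "z \<in> M" "liminf (\<lambda>N. ereal (orbit_mean T z N)) = 0"
    "\<And>c. \<exists>N\<ge>1. orbit_mean T z N > c"
proof -
  obtain r where r: "strict_mono r" "(\<lambda>k. ereal (orbit_mean T y (r k))) \<longlonglongrightarrow> 0"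
    using liminf_subseq_lim[of "\<lambda>N. ereal (orbit_mean T y N)"] y(2) by (auto simp: o_def)
  define D where "D = {z \<in> M. (\<lambda>k. orbit_mean T z (r k)) \<longlonglongrightarrow> 0}"
  have D: "subspace D"
    unfolding D_def by (rule subspace_mean_tendsto_0[OF T M(1)])
  have "y \<in> D"
    using y(1) r(2) by (simp add: D_def zero_ereal_def)
  \<comment> \<open>Invariance of \<open>D\<close> keeps the whole orbit of \<open>y\<close> in it.
    Absolute Cesaro boundedness on its closure would then make the means of \<open>y\<close>
    converge to 0.\<close>
  moreover have "T z \<in> D" if "z \<in> D" for z
  proof -
    have "(\<lambda>k. onorm T * orbit_mean T z (r k)) \<longlonglongrightarrow> 0"
      using that tendsto_mult_right_zero by (auto simp: D_def)
    then have "(\<lambda>k. orbit_mean T (T z) (r k)) \<longlonglongrightarrow> 0"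
      by (rule tendsto_0_le_nonneg) (simp_all add: orbit_mean_image_le[OF T])
    then show ?thesis using that M(3) by (auto simp: D_def)
  qed
  ultimately have "(T ^^ n) y \<in> D" for n
    by (induction n) auto
  then have not_acb: "\<not> abs_cesaro_bounded_in (closure D) T"
    using abs_cesaro_bounded_imp_mean_tendsto_0[of "closure D" T y] y closure_subset by blast
  have small: "(\<lambda>k. orbit_mean T z (r k)) \<longlonglongrightarrow> 0" if "z \<in> D" for z
    using that by (simp add: D_def)
  obtain z where z: "z \<in> closure D" "liminf (\<lambda>N. ereal (orbit_mean T z N)) = 0"
    "\<And>c. \<exists>N\<ge>1. orbit_mean T z N > c"
    using exists_mean_irregular_vector[OF complete T D filterlim_subseq[OF r(1)] small not_acb] by metis
  have "closure D \<subseteq> M"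
    using M(2) by (intro closure_minimal) (auto simp: D_def)
  then have "z \<in> M" using z(1) by blast
  then show thesis using z(2,3) by (rule that)
qed

subsection \<open>The space of functions vanishing at infinity\<close>

lemma in_C0_dominated:
  fixes \<phi> \<psi> :: "'a::topological_space \<Rightarrow>\<^sub>C 'k::real_normed_field"
  assumes "\<phi> \<in> C0" "\<And>x. norm (apply_bcontfun \<psi> x) \<le> norm (apply_bcontfun \<phi> x)"
  shows "\<psi> \<in> C0"
  unfolding C0_def
proof (intro CollectI allI impI)
  fix e :: real assume "e > 0"
  then have "compact {x. e \<le> norm (apply_bcontfun \<phi> x)}"
    using assms(1) by (simp add: C0_def)
  then show "compact {x. e \<le> norm (apply_bcontfun \<psi> x)}"
    by (rule compact_closed_subset[OF _ closed_superlevel]) (use assms(2) in \<open>force intro: order_trans\<close>)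
qed

lemma in_C0_compact_support:
  fixes \<phi> :: "'a::topological_space \<Rightarrow>\<^sub>C 'k::real_normed_field"
  assumes "compact K" "\<And>x. x \<notin> K \<Longrightarrow> apply_bcontfun \<phi> x = 0"
  shows "\<phi> \<in> C0"
  unfolding C0_def
proof (intro CollectI allI impI)
  fix e :: real assume "e > 0"
  then have "{x. e \<le> norm (apply_bcontfun \<phi> x)} \<subseteq> K"
    using assms(2) by force
  then show "compact {x. e \<le> norm (apply_bcontfun \<phi> x)}"
    by (rule compact_closed_subset[OF assms(1) closed_superlevel])
qed

lemma subspace_C0: "module.subspace scaleC0 (C0 :: ('a::t2_space \<Rightarrow>\<^sub>C 'k::real_normed_field) set)"
proof -
  interpret vector_space "scaleC0 :: 'k \<Rightarrow> ('a \<Rightarrow>\<^sub>C 'k) \<Rightarrow> _"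
    by (rule vector_space_scaleC0)
  show ?thesis
  proof (rule subspaceI)
    show "0 \<in> (C0 :: ('a \<Rightarrow>\<^sub>C 'k) set)"
      by (rule in_C0_compact_support[of "{}"]) auto
    fix \<phi> \<psi> :: "'a \<Rightarrow>\<^sub>C 'k" assume \<phi>: "\<phi> \<in> C0"
    show "\<phi> + \<psi> \<in> C0" if \<psi>: "\<psi> \<in> C0"
      unfolding C0_def
    proof (intro CollectI allI impI)
      fix e :: real assume "e > 0"
      then have "compact ({x. e / 2 \<le> norm (apply_bcontfun \<phi> x)} \<union> {x. e / 2 \<le> norm (apply_bcontfun \<psi> x)})"
        using \<phi> \<psi> half_gt_zero[OF \<open>e > 0\<close>] unfolding C0_def by (intro compact_Un) blast+
      moreover have "e / 2 \<le> norm (apply_bcontfun \<phi> x) \<or> e / 2 \<le> norm (apply_bcontfun \<psi> x)"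
        if "e \<le> norm (apply_bcontfun (\<phi> + \<psi>) x)" for x
        using that norm_triangle_ineq[of "apply_bcontfun \<phi> x" "apply_bcontfun \<psi> x"] by auto
      ultimately show "compact {x. e \<le> norm (apply_bcontfun (\<phi> + \<psi>) x)}"
        by (elim compact_closed_subset[OF _ closed_superlevel]) blast
    qed
    show "scaleC0 c \<phi> \<in> C0" for c
      unfolding C0_def
    proof (intro CollectI allI impI)
      fix e :: real assume "e > 0"
      \<comment> \<open>Adding 1 covers \<open>c = 0\<close>.\<close>
      then have "compact {x. e / (norm c + 1) \<le> norm (apply_bcontfun \<phi> x)}"
        using \<phi> by (simp add: C0_def add_nonneg_pos)
      moreover have "e / (norm c + 1) \<le> norm (apply_bcontfun \<phi> x)"
        if "e \<le> norm c * norm (apply_bcontfun \<phi> x)" for x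
      proof -
        have "norm c * norm (apply_bcontfun \<phi> x) \<le> norm (apply_bcontfun \<phi> x) * (norm c + 1)"
          by (simp add: algebra_simps)
        with that show ?thesis
          by (simp add: pos_divide_le_eq add_nonneg_pos)
      qed
      ultimately show "compact {x. e \<le> norm (apply_bcontfun (scaleC0 c \<phi>) x)}"
        by (elim compact_closed_subset[OF _ closed_superlevel]) (auto simp: norm_mult)
    qed
  qed
qed

text \<open>The library has this completeness only for functions on a metric space.\<close>

lemma complete_UNIV_bcontfun: "complete (UNIV :: ('a::topological_space \<Rightarrow>\<^sub>C 'b::complete_space) set)"
  unfolding complete_def
proof (intro allI impI, elim conjE)
  fix u :: "nat \<Rightarrow> ('a \<Rightarrow>\<^sub>C 'b)"
  assume "Cauchy u"
  then obtain g where "uniform_limit UNIV (\<lambda>n. apply_bcontfun (u n)) g sequentially"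
    using uniformly_convergent_eq_cauchy[of "\<lambda>_. True" "\<lambda>n. apply_bcontfun (u n)"]
    unfolding Cauchy_def uniform_limit_sequentially_iff
    by (metis dist_fun_lt_imp_dist_val_lt)
  then obtain l where "u \<longlonglongrightarrow> l"
    using uniform_limit_bcontfunE[OF _ sequentially_bot] by metis
  then show "\<exists>l\<in>UNIV. u \<longlonglongrightarrow> l" by blast
qed

lemma scaleR_eq_scaleC0:
  fixes \<phi> :: "'a::topological_space \<Rightarrow>\<^sub>C 'k::real_normed_field"
  shows "c *\<^sub>R \<phi> = scaleC0 (of_real c) \<phi>"
  by (rule bcontfun_eqI) (simp add: scaleR_conv_of_real)

text \<open>The results on general operators are over the reals, whereas the span in the theorem is
  over \<open>'k\<close>; both structures are therefore needed on \<open>C0\<close>.\<close>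

lemma subspace_C0_real: "subspace (C0 :: ('a::t2_space \<Rightarrow>\<^sub>C 'k::real_normed_field) set)"
proof -
  interpret K: vector_space "scaleC0 :: 'k \<Rightarrow> ('a \<Rightarrow>\<^sub>C 'k) \<Rightarrow> _"
    by (rule vector_space_scaleC0)
  show ?thesis
    using subspace_C0[where 'a='a and 'k='k]
    by (auto simp: subspace_def K.subspace_def scaleR_eq_scaleC0)
qed

lemma closure_superlevel_subset:
  fixes \<phi> :: "'a::topological_space \<Rightarrow>\<^sub>C 'k::real_normed_field"
  assumes "d \<le> c"
  shows "closure {x. c < norm (apply_bcontfun \<phi> x)} \<subseteq> {x. d \<le> norm (apply_bcontfun \<phi> x)}"
  using assms by (intro closure_minimal closed_superlevel) auto

lemma rel_compact_open_superlevel: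
  fixes \<phi> :: "'a::topological_space \<Rightarrow>\<^sub>C 'k::real_normed_field"
  assumes "\<phi> \<in> C0" "d > 0"
  shows "rel_compact_open {x. d < norm (apply_bcontfun \<phi> x)}"
proof -
  have "compact (closure {x. d < norm (apply_bcontfun \<phi> x)})"
    using assms by (intro compact_closed_subset[OF _ _ closure_superlevel_subset[OF order_refl]])
      (auto simp: C0_def)
  then show ?thesis
    by (auto simp: rel_compact_open_def intro!: open_Collect_less continuous_intros)
qed

text \<open>A Urysohn function vanishing off \<open>U\<close> may still have support reaching the
  boundary of \<open>U\<close>. Cutting it off below the value 1/2 pushes the support
  inside.\<close>

lemma Urysohn_bump:
  fixes K U :: "'a::t2_space set"
  assumes lc: "locally_compact_space (euclidean :: 'a topology)"
    and K: "compact K" and U: "rel_compact_open U" and "K \<subseteq> U"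
  obtains \<phi> :: "'a \<Rightarrow>\<^sub>C 'k::real_normed_field" where "\<phi> \<in> C0" "norm \<phi> \<le> 1"
    "\<And>x. x \<in> K \<Longrightarrow> apply_bcontfun \<phi> x = 1"
    "closure {x. apply_bcontfun \<phi> x \<noteq> 0} \<subseteq> U"
proof -
  have "Hausdorff_space (euclidean :: 'a topology)"
    unfolding Hausdorff_space_def disjnt_def
    by (metis hausdorff open_openin)
  then have "completely_regular_space (euclidean :: 'a topology)"
    using lc locally_compact_regular_imp_completely_regular_space by blast
  moreover have "closedin euclidean (- U)"
    using U by (simp add: rel_compact_open_def closed_Compl)
  ultimately obtain g :: "'a \<Rightarrow> real" where g: "continuous_map euclidean euclideanreal g"
      "g ` (- U) \<subseteq> {0}" "g ` K \<subseteq> {1}"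
    using K \<open>K \<subseteq> U\<close>
    by (elim Urysohn_completely_regular_compact_closed_alt[of euclidean K "- U" 0 1]) (auto simp: disjnt_def)
  have cont: "continuous_on UNIV g"
    using g(1) by simp
  \<comment> \<open>This is 0 where \<open>g\<close> is at most 1/2 and 1 where \<open>g\<close> is
    1; the clamping also bounds it, as nothing is known of the range of \<open>g\<close>.\<close>
  define h where "h = (\<lambda>x. min 1 (max 0 (2 * g x - 1)))"
  have h: "0 \<le> h x" "h x \<le> 1" for x
    by (auto simp: h_def)
  have "(\<lambda>x. of_real (h x) :: 'k) \<in> bcontfun"
    unfolding h_def by (rule bcontfun_normI[where b=1]) (auto intro!: continuous_intros cont)
  then have ap: "apply_bcontfun (Bcontfun (\<lambda>x. of_real (h x) :: 'k)) x = of_real (h x)" for x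
    by (simp add: Bcontfun_inverse)
  have "closure {x. h x \<noteq> 0} \<subseteq> {x. 1 / 2 \<le> g x}"
    by (intro closure_minimal closed_Collect_le continuous_intros cont) (auto simp: h_def)
  also have "\<dots> \<subseteq> U"
    using g(2) by force
  finally have supp: "closure {x. h x \<noteq> 0} \<subseteq> U" .
  show thesis
  proof
    let ?\<phi> = "Bcontfun (\<lambda>x. of_real (h x) :: 'k)"
    show "?\<phi> \<in> C0"
    proof (rule in_C0_compact_support)
      show "compact (closure U)" using U by (simp add: rel_compact_open_def)
      show "apply_bcontfun ?\<phi> x = 0" if "x \<notin> closure U" for x
        using that supp closure_subset[of U] closure_subset[of "{x. h x \<noteq> 0}"] by (auto simp: ap)
    qed
    show "norm ?\<phi> \<le> 1"
      using h by (intro norm_bound) (simp add: ap)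
    show "apply_bcontfun ?\<phi> x = 1" if "x \<in> K" for x
      using g(3) that unfolding ap by (auto simp: h_def)
    show "closure {x. apply_bcontfun ?\<phi> x \<noteq> 0} \<subseteq> U"
      using supp by (simp add: ap)
  qed
qed

subsection \<open>Weighted composition operators\<close>

lemma norm_le_sup_norm_on:
  assumes "bounded (range \<phi>)" "x \<in> B"
  shows "norm (\<phi> x) \<le> sup_norm_on B \<phi>"
proof -
  have "bdd_above ((\<lambda>x. norm (\<phi> x)) ` B)"
    using assms(1) by (auto simp: bounded_iff bdd_above_def)
  then show ?thesis
    using assms(2) by (auto simp: sup_norm_on_def intro: cSUP_upper)
qed

text \<open>The condition \<open>0 \<le> c\<close> accounts for empty \<open>B\<close>, where the
  value is 0 by convention.\<close>

lemma sup_norm_on_least: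
  "0 \<le> c \<Longrightarrow> (\<And>x. x \<in> B \<Longrightarrow> norm (\<phi> x) \<le> c) \<Longrightarrow> sup_norm_on B \<phi> \<le> c"
  by (auto simp: sup_norm_on_def intro: cSUP_least)

lemma sup_norm_on_nonneg:
  assumes "bounded (range \<phi>)"
  shows "0 \<le> sup_norm_on B \<phi>"
proof (cases "B = {}")
  case False
  then show ?thesis
    using norm_le_sup_norm_on[OF assms] norm_ge_zero order_trans by (metis ex_in_conv)
qed (simp add: sup_norm_on_def)

text \<open>Covers real and complex scalars at once; \<open>banach\<close> makes the function space
  complete for the category argument.\<close>

locale weighted_composition =
  fixes w :: "'a::t2_space \<Rightarrow> 'k::{real_normed_field,banach}" and f :: "'a \<Rightarrow> 'a"
  assumes wf: "weight_map_pair w f"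
begin

abbreviation T :: "('a \<Rightarrow>\<^sub>C 'k) \<Rightarrow> ('a \<Rightarrow>\<^sub>C 'k)" where
  "T \<equiv> weighted_comp w f"

lemma apply_funpow_weighted_comp:
  "apply_bcontfun ((T ^^ n) \<phi>) x = apply_bcontfun \<phi> ((f ^^ n) x) * iter_weight w f n x"
proof (induction n arbitrary: x)
  case 0
  show ?case by (simp add: iter_weight_def)
next
  case (Suc n)
  \<comment> \<open>The factor of index 0 is split off, so that the induction hypothesis applies at
    \<open>f x\<close>.\<close>
  have "iter_weight w f (Suc n) x = iter_weight w f n (f x) * w x"
    unfolding iter_weight_def by (subst prod.lessThan_Suc_shift) (simp add: funpow_swap1 mult.commute)
  moreover have "(f ^^ Suc n) x = (f ^^ n) (f x)"
    by (simp add: funpow_swap1)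
  moreover have "apply_bcontfun ((T ^^ Suc n) \<phi>) x = apply_bcontfun ((T ^^ n) \<phi>) (f x) * w x"
    by (simp add: apply_weighted_comp[OF wf])
  ultimately show ?case
    by (simp only: Suc mult.assoc)
qed

lemma weight_bound:
  obtains b where "b > 0" "\<And>x. norm (w x) \<le> b"
  using wf unfolding weight_map_pair_def bounded_pos by auto

text \<open>This crude bound suffices: beyond boundedness for each \<open>n\<close>, it is only used
  up to a fixed \<open>N\<close>, multiplied by thresholds that tend to 0.\<close>

lemma norm_iter_weight_le:
  assumes "\<And>x. norm (w x) \<le> b"
  shows "norm (iter_weight w f n x) \<le> b ^ n"
  unfolding iter_weight_def prod_norm[symmetric]
  using prod_mono[of "{..<n}" "\<lambda>i. norm (w ((f ^^ i) x))" "\<lambda>_. b"] assms by simp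

lemma bounded_iter_weight: "bounded (range (iter_weight w f n))"
proof -
  obtain b where "\<And>x. norm (w x) \<le> b" using weight_bound by blast
  then have "norm (iter_weight w f n x) \<le> b ^ n" for x by (rule norm_iter_weight_le)
  then show ?thesis unfolding bounded_iff by blast
qed

lemma bounded_linear_weighted_comp: "bounded_linear T"
proof -
  obtain b where b: "b > 0" "\<And>x. norm (w x) \<le> b" using weight_bound by blast
  show ?thesis
  proof (rule bounded_linear_intro[where K=b])
    show "T (\<phi> + \<psi>) = T \<phi> + T \<psi>" "T (c *\<^sub>R \<phi>) = c *\<^sub>R T \<phi>" for c \<phi> \<psi>
      by (auto intro!: bcontfun_eqI simp: apply_weighted_comp[OF wf] algebra_simps)
    show "norm (T \<phi>) \<le> norm \<phi> * b" for \<phi>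
      by (rule norm_bound)
        (auto simp: apply_weighted_comp[OF wf] norm_mult intro!: mult_mono norm_bounded b(2))
  qed
qed

lemma weight_mean_nonneg [simp]: "0 \<le> weight_mean w f B N"
  unfolding weight_mean_def by (intro cesaro_mean_nonneg sup_norm_on_nonneg bounded_iter_weight)

text \<open>\<open>(T ^^ n) \<phi>\<close> vanishes at \<open>x\<close> unless
  \<open>(f ^^ n) x\<close> lies in \<open>B\<close>, so only the weight over the preimage of
  \<open>B\<close> counts.\<close>

lemma orbit_mean_le_weight_mean:
  assumes "\<And>x. x \<notin> B \<Longrightarrow> apply_bcontfun \<phi> x = 0"
  shows "orbit_mean T \<phi> N \<le> norm \<phi> * weight_mean w f B N"
  unfolding orbit_mean_def weight_mean_def cesaro_mean_cmult[symmetric]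
proof (intro cesaro_mean_mono norm_bound)
  fix n x
  have nn: "0 \<le> sup_norm_on ((f ^^ n) -` B) (iter_weight w f n)"
    by (intro sup_norm_on_nonneg bounded_iter_weight)
  show "norm (apply_bcontfun ((T ^^ n) \<phi>) x)
      \<le> norm \<phi> * sup_norm_on ((f ^^ n) -` B) (iter_weight w f n)"
  proof (cases "(f ^^ n) x \<in> B")
    case True
    then show ?thesis
      unfolding apply_funpow_weighted_comp norm_mult
      by (intro mult_mono norm_bounded norm_le_sup_norm_on bounded_iter_weight) auto
  next
    case False
    then show ?thesis
      using nn by (simp add: apply_funpow_weighted_comp assms)
  qed
qed

text \<open>Over the preimage of \<open>B\<close>, the values of \<open>(T ^^ n) \<phi>\<close> are
  at least \<open>c\<close> times the iterated weight in norm.\<close>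

lemma weight_mean_le_orbit_mean:
  assumes "c > 0" "\<And>x. x \<in> B \<Longrightarrow> c \<le> norm (apply_bcontfun \<phi> x)"
  shows "weight_mean w f B N \<le> (1 / c) * orbit_mean T \<phi> N"
  unfolding orbit_mean_def weight_mean_def cesaro_mean_cmult[symmetric]
proof (intro cesaro_mean_mono sup_norm_on_least)
  fix n x assume "x \<in> (f ^^ n) -` B"
  then have "c * norm (iter_weight w f n x) \<le> norm (apply_bcontfun ((T ^^ n) \<phi>) x)"
    unfolding apply_funpow_weighted_comp norm_mult by (intro mult_right_mono assms(2)) auto
  also have "\<dots> \<le> norm ((T ^^ n) \<phi>)" by (rule norm_bounded)
  finally show "norm (iter_weight w f n x) \<le> 1 / c * norm ((T ^^ n) \<phi>)"
    using assms(1) by (simp add: field_simps)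
qed (use assms(1) in simp)

lemma orbit_mean_scaleC0_le: "orbit_mean T (scaleC0 c \<phi>) N \<le> norm c * orbit_mean T \<phi> N"
  unfolding orbit_mean_def cesaro_mean_cmult[symmetric]
proof (intro cesaro_mean_mono norm_bound)
  fix n x
  have "norm (apply_bcontfun ((T ^^ n) (scaleC0 c \<phi>)) x) = norm c * norm (apply_bcontfun ((T ^^ n) \<phi>) x)"
    by (simp add: apply_funpow_weighted_comp norm_mult)
  also have "\<dots> \<le> norm c * norm ((T ^^ n) \<phi>)"
    by (intro mult_left_mono norm_bounded) auto
  finally show "norm (apply_bcontfun ((T ^^ n) (scaleC0 c \<phi>)) x) \<le> norm c * norm ((T ^^ n) \<phi>)" .
qed

section \<open>The closed span of the functions of small support\<close>

text \<open>Repeats the generating set of \<open>small_support_space\<close> verbatim, so that it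
  can be folded there.\<close>

definition small_support_functions :: "('a \<Rightarrow>\<^sub>C 'k) set" where
  "small_support_functions = {\<phi> \<in> C0. \<exists>B. rel_compact_open B \<and>
     closure {x. apply_bcontfun \<phi> x \<noteq> 0} \<subseteq> B \<and> liminf (\<lambda>N. ereal (weight_mean w f B N)) = 0}"

lemma small_support_functions_subset: "small_support_functions \<subseteq> small_support_space w f"
proof -
  interpret vector_space "scaleC0 :: 'k \<Rightarrow> ('a \<Rightarrow>\<^sub>C 'k) \<Rightarrow> _"
    by (rule vector_space_scaleC0)
  show ?thesis
    unfolding small_support_space_def small_support_functions_def[symmetric]
    using span_superset closure_subset by (rule subset_trans)
qed

lemma liminf_orbit_mean_small_support:
  assumes "\<phi> \<in> small_support_functions"
  shows "liminf (\<lambda>N. ereal (orbit_mean T \<phi> N)) = 0"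
proof -
  obtain B where "closure {x. apply_bcontfun \<phi> x \<noteq> 0} \<subseteq> B" and
    B: "liminf (\<lambda>N. ereal (weight_mean w f B N)) = 0"
    using assms by (auto simp: small_support_functions_def)
  then have "x \<notin> B \<Longrightarrow> apply_bcontfun \<phi> x = 0" for x
    using closure_subset[of "{x. apply_bcontfun \<phi> x \<noteq> 0}"] by blast
  then show ?thesis
    by (rule liminf_eq_0_mono[OF orbit_mean_nonneg weight_mean_nonneg orbit_mean_le_weight_mean B])
qed

lemma liminf_weight_mean_superlevel:
  assumes "d > 0" "liminf (\<lambda>N. ereal (orbit_mean T \<phi> N)) = 0"
  shows "liminf (\<lambda>N. ereal (weight_mean w f {x. d < norm (apply_bcontfun \<phi> x)} N)) = 0"
  by (rule liminf_eq_0_mono[OF weight_mean_nonneg orbit_mean_nonneg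
        weight_mean_le_orbit_mean[OF assms(1)] assms(2)]) simp

text \<open>Cutting \<open>\<phi>\<close> off where it is small gives approximations of \<open>\<phi>\<close> whose supports lie in superlevel sets.\<close>

lemma small_support_space_superset:
  assumes \<phi>: "\<phi> \<in> C0" "liminf (\<lambda>N. ereal (orbit_mean T \<phi> N)) = 0"
  shows "\<phi> \<in> small_support_space w f"
proof -
  have "\<exists>\<psi>\<in>small_support_functions. dist \<psi> \<phi> < e" if "e > 0" for e
  proof -
    define d where "d = e / 3"
    have "d > 0" using that by (simp add: d_def)
    \<comment> \<open>The cutoff is 0 where the norm of \<open>\<phi>\<close> is at most
      \<open>d\<close> and 1 where it is at least \<open>2 * d\<close>; the product with
      \<open>\<phi>\<close> differs from \<open>\<phi>\<close> by at most
      \<open>2 * d < e\<close>.\<close>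
    define h where "h = (\<lambda>x. min 1 (max 0 (norm (apply_bcontfun \<phi> x) / d - 1)))"
    have h: "0 \<le> h x" "h x \<le> 1" for x
      by (auto simp: h_def)
    have le: "norm (h x *\<^sub>R apply_bcontfun \<phi> x) \<le> norm (apply_bcontfun \<phi> x)" for x
      using h[of x] by (simp add: mult_left_le_one_le)
    have "(\<lambda>x. h x *\<^sub>R apply_bcontfun \<phi> x) \<in> bcontfun"
      using le norm_bounded \<open>d > 0\<close> unfolding h_def
      by (intro bcontfun_normI[where b="norm \<phi>"]) (auto intro!: continuous_intros intro: order_trans)
    define \<psi> where "\<psi> = Bcontfun (\<lambda>x. h x *\<^sub>R apply_bcontfun \<phi> x)"
    have \<psi>: "apply_bcontfun \<psi> x = h x *\<^sub>R apply_bcontfun \<phi> x" for x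
      unfolding \<psi>_def by (simp add: Bcontfun_inverse \<open>_ \<in> bcontfun\<close>)
    have "\<psi> \<in> C0"
      using \<phi>(1) by (rule in_C0_dominated) (simp only: \<psi> le)
    \<comment> \<open>The support can meet the level \<open>d\<close> itself, so the open set around
      it needs a smaller threshold.\<close>
    moreover have "closure {x. apply_bcontfun \<psi> x \<noteq> 0} \<subseteq> {x. d / 2 < norm (apply_bcontfun \<phi> x)}"
    proof -
      have "{x. apply_bcontfun \<psi> x \<noteq> 0} \<subseteq> {x. d < norm (apply_bcontfun \<phi> x)}"
        using \<open>d > 0\<close> by (auto simp: \<psi> h_def field_simps min_def max_def split: if_splits)
      then have "closure {x. apply_bcontfun \<psi> x \<noteq> 0} \<subseteq> {x. d \<le> norm (apply_bcontfun \<phi> x)}"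
        by (rule order_trans[OF closure_mono closure_superlevel_subset[OF order_refl]])
      then show ?thesis using \<open>d > 0\<close> by force
    qed
    moreover have "rel_compact_open {x. d / 2 < norm (apply_bcontfun \<phi> x)}"
      using \<phi>(1) \<open>d > 0\<close> by (intro rel_compact_open_superlevel) auto
    moreover have "liminf (\<lambda>N. ereal (weight_mean w f {x. d / 2 < norm (apply_bcontfun \<phi> x)} N)) = 0"
      using \<phi>(2) \<open>d > 0\<close> by (intro liminf_weight_mean_superlevel) auto
    ultimately have "\<psi> \<in> small_support_functions"
      unfolding small_support_functions_def by blast
    moreover have "norm (\<psi> - \<phi>) \<le> 2 * d"
    proof (rule norm_bound)
      fix x
      have "apply_bcontfun (\<psi> - \<phi>) x = - ((1 - h x) *\<^sub>R apply_bcontfun \<phi> x)"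
        by (simp add: \<psi> scaleR_diff_left)
      then have eq: "norm (apply_bcontfun (\<psi> - \<phi>) x) = (1 - h x) * norm (apply_bcontfun \<phi> x)"
        using h[of x] by simp
      show "norm (apply_bcontfun (\<psi> - \<phi>) x) \<le> 2 * d"
      proof (cases "norm (apply_bcontfun \<phi> x) \<le> 2 * d")
        case True
        have "(1 - h x) * norm (apply_bcontfun \<phi> x) \<le> norm (apply_bcontfun \<phi> x)"
          using h[of x] by (simp add: mult_left_le_one_le)
        with True show ?thesis by (simp only: eq)
      next
        case False
        then have "h x = 1" using \<open>d > 0\<close> by (simp add: h_def field_simps)
        then show ?thesis using \<open>d > 0\<close> by (simp only: eq) simp
      qed
    qed
    ultimately show ?thesis
      using \<open>e > 0\<close> by (intro bexI[of _ \<psi>]) (auto simp: dist_norm d_def)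
  qed
  then have "\<phi> \<in> closure small_support_functions"
    by (auto simp: closure_approachable)
  also have "\<dots> \<subseteq> small_support_space w f"
    using small_support_functions_subset
    by (intro closure_minimal) (auto simp: small_support_space_def)
  finally show ?thesis .
qed

lemma funpow_weighted_comp_in_C0: "\<phi> \<in> C0 \<Longrightarrow> (T ^^ n) \<phi> \<in> C0"
  by (induction n) (simp_all add: weighted_comp_in_C0[OF wf])

section \<open>Irregular functions, chaos and Cesaro boundedness\<close>

abbreviation mean_irregular :: "('a \<Rightarrow>\<^sub>C 'k) \<Rightarrow> bool" where
  "mean_irregular \<phi> \<equiv> liminf (\<lambda>N. ereal (orbit_mean T \<phi> N)) = 0 \<and> (\<forall>c. \<exists>N\<ge>1. c < orbit_mean T \<phi> N)"

lemmas chaotic_iff = mean_li_yorke_chaotic_iff[OF bounded_linear_weighted_comp subspace_C0_real]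

text \<open>Convergent sequences are bounded, so an irregular function is semi-irregular.\<close>

lemma irregular_imp_chaotic:
  assumes "\<phi> \<in> C0" "mean_irregular \<phi>"
  shows "mean_li_yorke_chaotic C0 T"
proof -
  have "\<not> orbit_mean T \<phi> \<longlonglongrightarrow> 0"
  proof
    assume "orbit_mean T \<phi> \<longlonglongrightarrow> 0"
    then obtain c where "\<And>N. norm (orbit_mean T \<phi> N) \<le> c"
      using convergent_imp_Bseq[unfolded convergent_def] BseqE by metis
    then have "orbit_mean T \<phi> N \<le> c" for N by simp
    then show False using assms(2) by (meson not_less)
  qed
  then show ?thesis using assms chaotic_iff by blast
qed

text \<open>The whole orbit of a semi-irregular function has means with limit inferior 0 and hence
  lies in the closed span, where boundedness would make the means of the function converge to
  0.\<close>

lemma chaotic_imp_not_abs_cesaro_bounded: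
  assumes "mean_li_yorke_chaotic C0 T"
  shows "\<not> abs_cesaro_bounded_in (small_support_space w f) T"
proof -
  obtain \<phi> where \<phi>: "\<phi> \<in> C0" "liminf (\<lambda>N. ereal (orbit_mean T \<phi> N)) = 0"
    and not_null: "\<not> orbit_mean T \<phi> \<longlonglongrightarrow> 0"
    using assms chaotic_iff by blast
  then have "(T ^^ n) \<phi> \<in> small_support_space w f" for n
    by (intro small_support_space_superset funpow_weighted_comp_in_C0
        liminf_orbit_mean_funpow bounded_linear_weighted_comp)
  then show ?thesis
    using abs_cesaro_bounded_imp_mean_tendsto_0 \<phi>(2) not_null by blast
qed

lemma not_abs_cesaro_bounded_imp_irregular:
  assumes not_acb: "\<not> abs_cesaro_bounded_in (small_support_space w f) T"
  obtains \<phi> where "\<phi> \<in> C0" "mean_irregular \<phi>"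
proof (cases "\<forall>\<phi>\<in>small_support_functions. orbit_mean T \<phi> \<longlonglongrightarrow> 0")
  case True
  interpret K: vector_space "scaleC0 :: 'k \<Rightarrow> ('a \<Rightarrow>\<^sub>C 'k) \<Rightarrow> _"
    by (rule vector_space_scaleC0)
  define D where "D = {\<phi> \<in> C0. orbit_mean T \<phi> \<longlonglongrightarrow> 0}"
  have D: "subspace D"
    unfolding D_def by (rule subspace_mean_tendsto_0[OF bounded_linear_weighted_comp subspace_C0_real])
  \<comment> \<open>The span is taken over \<open>'k\<close>, so closure under real scalars alone
    would not give the inclusion in \<open>closure D\<close>.\<close>
  have "K.subspace D"
  proof (rule K.subspaceI)
    show "0 \<in> D" "\<And>\<phi> \<psi>. \<phi> \<in> D \<Longrightarrow> \<psi> \<in> D \<Longrightarrow> \<phi> + \<psi> \<in> D"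
      using D by (auto simp: subspace_0 subspace_add)
    show "scaleC0 c \<phi> \<in> D" if "\<phi> \<in> D" for c \<phi>
    proof -
      have "(\<lambda>N. norm c * orbit_mean T \<phi> N) \<longlonglongrightarrow> 0"
        using that tendsto_mult_right_zero by (auto simp: D_def)
      then have "orbit_mean T (scaleC0 c \<phi>) \<longlonglongrightarrow> 0"
        by (rule tendsto_0_le_nonneg) (simp_all add: orbit_mean_scaleC0_le)
      then show ?thesis
        using that K.subspace_scale[OF subspace_C0] by (auto simp: D_def)
    qed
  qed
  moreover have "small_support_functions \<subseteq> D"
    using True by (auto simp: D_def small_support_functions_def)
  ultimately have "small_support_space w f \<subseteq> closure D"
    unfolding small_support_space_def small_support_functions_def[symmetric]
    by (intro closure_mono K.span_minimal)
  then have "\<not> abs_cesaro_bounded_in (closure D) T"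
    using not_acb abs_cesaro_bounded_in_subset by blast
  moreover have "orbit_mean T \<phi> \<longlonglongrightarrow> 0" if "\<phi> \<in> D" for \<phi>
    using that by (simp add: D_def)
  ultimately obtain \<phi> where "\<phi> \<in> closure D" "mean_irregular \<phi>"
    using exists_mean_irregular_vector[OF complete_UNIV_bcontfun bounded_linear_weighted_comp D filterlim_ident] by metis
  moreover have "closure D \<subseteq> C0"
    by (intro closure_minimal closed_C0) (auto simp: D_def)
  ultimately show thesis using that by blast
next
  case False
  then obtain \<phi> where \<phi>: "\<phi> \<in> small_support_functions" "\<not> orbit_mean T \<phi> \<longlonglongrightarrow> 0" by blast
  then have "\<phi> \<in> C0" by (simp add: small_support_functions_def)
  have "T ` C0 \<subseteq> C0"
    using weighted_comp_in_C0[OF wf] by blast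
  from semi_irregular_imp_irregular[OF complete_UNIV_bcontfun bounded_linear_weighted_comp subspace_C0_real closed_C0 this
      \<open>\<phi> \<in> C0\<close> liminf_orbit_mean_small_support[OF \<phi>(1)] \<phi>(2)]
  show thesis using that by metis
qed

section \<open>Growing sequences of relatively compact open sets\<close>

definition growing_sets :: "(nat \<Rightarrow> 'a set) \<Rightarrow> bool" where
  "growing_sets B \<longleftrightarrow>
    (\<forall>i. rel_compact_open (B i)) \<and>
    (\<forall>i. closure (B i) \<subseteq> B (Suc i)) \<and>
    (\<forall>i. liminf (\<lambda>N. ereal (weight_mean w f (B i) N)) = 0) \<and>
    (SUP (i, N) \<in> UNIV \<times> {1..}. ereal (weight_mean w f (B i) N)) = \<infinity>"

lemma SUP_weight_mean_eq_infinity_iff: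
  "(SUP (i, N) \<in> UNIV \<times> {1..}. ereal (weight_mean w f (B i) N)) = \<infinity>
    \<longleftrightarrow> (\<forall>c. \<exists>i. \<exists>N\<ge>1. c < weight_mean w f (B i) N)" (is "?S = _ \<longleftrightarrow> _")
proof -
  have "x = \<infinity> \<longleftrightarrow> (\<forall>c. ereal c < x)" for x :: ereal
    by (cases x) auto
  then have "?S = \<infinity> \<longleftrightarrow> (\<forall>c. ereal c < ?S)" .
  also have "\<dots> \<longleftrightarrow> (\<forall>c. \<exists>i. \<exists>N\<ge>1. c < weight_mean w f (B i) N)"
    by (simp add: less_SUP_iff Bex_def)
  finally show ?thesis .
qed

text \<open>The superlevel sets of \<open>\<phi>\<close> exhaust the set where \<open>\<phi>\<close>
  is nonzero. If their weight means had a common bound \<open>c\<close>, the orbit means of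
  \<open>\<phi>\<close> would be bounded by \<open>norm \<phi> * c\<close>.\<close>

lemma irregular_imp_growing_sets:
  assumes \<phi>: "\<phi> \<in> C0" "mean_irregular \<phi>"
  shows "\<exists>B. growing_sets B"
proof -
  \<comment> \<open>Strict decrease puts the closure of each superlevel set inside the next one;
    convergence to 0 removes the error term below.\<close>
  define d where "d = (\<lambda>i. 1 / real (Suc i))"
  have d: "d i > 0" "d (Suc i) < d i" for i
    by (auto simp: d_def field_simps)
  define B where "B = (\<lambda>i. {x. d i < norm (apply_bcontfun \<phi> x)})"
  obtain b where b: "b > 0" "\<And>x. norm (w x) \<le> b" using weight_bound by blast
  have "\<exists>i. \<exists>N\<ge>1. c < weight_mean w f (B i) N" for c
  proof (rule ccontr)
    assume "\<not> ?thesis"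
    then have le_c: "weight_mean w f (B i) N \<le> c" if "N \<ge> 1" for i N
      using that by (meson not_less)
    \<comment> \<open>With \<open>N\<close> fixed, points sent into \<open>B i\<close> contribute at
      most the weight mean and the others at most \<open>d i * b ^ n\<close>; then \<open>i\<close>
      tends to infinity.\<close>
    have "orbit_mean T \<phi> N \<le> norm \<phi> * c" if "N \<ge> 1" for N
    proof (rule LIMSEQ_le_const)
      have "d \<longlonglongrightarrow> 0"
        unfolding d_def using LIMSEQ_inverse_real_of_nat by (simp add: inverse_eq_divide)
      then have "(\<lambda>i. norm \<phi> * c + d i * cesaro_mean (\<lambda>n. b ^ n) N) \<longlonglongrightarrow> norm \<phi> * c + 0 * cesaro_mean (\<lambda>n. b ^ n) N"
        by (intro tendsto_intros)
      then show "(\<lambda>i. norm \<phi> * c + d i * cesaro_mean (\<lambda>n. b ^ n) N) \<longlonglongrightarrow> norm \<phi> * c"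
        by simp
      have "orbit_mean T \<phi> N \<le> norm \<phi> * c + d i * cesaro_mean (\<lambda>n. b ^ n) N" for i
      proof -
        have "orbit_mean T \<phi> N \<le> norm \<phi> * weight_mean w f (B i) N + d i * cesaro_mean (\<lambda>n. b ^ n) N"
          unfolding orbit_mean_def weight_mean_def cesaro_mean_cmult[symmetric] cesaro_mean_add[symmetric]
        proof (intro cesaro_mean_mono norm_bound)
          fix n x
          let ?s = "sup_norm_on ((f ^^ n) -` B i) (iter_weight w f n)"
          have nonneg: "0 \<le> norm \<phi> * ?s" "0 \<le> d i * b ^ n"
            using b d[of i] by (auto intro!: mult_nonneg_nonneg sup_norm_on_nonneg bounded_iter_weight)
          have "norm (apply_bcontfun \<phi> ((f ^^ n) x)) * norm (iter_weight w f n x) \<le> norm \<phi> * ?s + d i * b ^ n"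
          proof (cases "(f ^^ n) x \<in> B i")
            case True
            then have "norm (apply_bcontfun \<phi> ((f ^^ n) x)) * norm (iter_weight w f n x) \<le> norm \<phi> * ?s"
              by (intro mult_mono norm_bounded norm_le_sup_norm_on bounded_iter_weight) auto
            with nonneg show ?thesis by linarith
          next
            case False
            then have "norm (apply_bcontfun \<phi> ((f ^^ n) x)) * norm (iter_weight w f n x) \<le> d i * b ^ n"
              using d[of i] by (intro mult_mono norm_iter_weight_le b(2)) (auto simp: B_def)
            with nonneg show ?thesis by linarith
          qed
          then show "norm (apply_bcontfun ((T ^^ n) \<phi>) x) \<le> norm \<phi> * ?s + d i * b ^ n"
            by (simp add: apply_funpow_weighted_comp norm_mult)
        qed
        also have "norm \<phi> * weight_mean w f (B i) N \<le> norm \<phi> * c"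
          using le_c[OF that] by (intro mult_left_mono) auto
        finally show ?thesis by simp
      qed
      then show "\<exists>M. \<forall>i\<ge>M. orbit_mean T \<phi> N \<le> norm \<phi> * c + d i * cesaro_mean (\<lambda>n. b ^ n) N"
        by blast
    qed
    then show False using \<phi>(2) by (meson not_less)
  qed
  moreover have "closure (B i) \<subseteq> B (Suc i)" for i
  proof -
    have "closure (B i) \<subseteq> {x. d i \<le> norm (apply_bcontfun \<phi> x)}"
      unfolding B_def by (rule closure_superlevel_subset) simp
    then show ?thesis using d(2)[of i] by (force simp: B_def)
  qed
  moreover have "liminf (\<lambda>N. ereal (weight_mean w f (B i) N)) = 0" for i
    unfolding B_def using d \<phi>(2) by (intro liminf_weight_mean_superlevel) auto
  moreover have "rel_compact_open (B i)" for i
    unfolding B_def using d \<phi>(1) by (intro rel_compact_open_superlevel)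
  ultimately have "growing_sets B"
    unfolding growing_sets_def SUP_weight_mean_eq_infinity_iff by blast
  then show ?thesis by blast
qed

text \<open>A Urysohn function that is 1 on \<open>closure (B i)\<close> with support in
  \<open>B (Suc i)\<close> belongs to the generators. Its norm is at most 1, while its orbit means
  dominate the weight means of \<open>B i\<close>, which exceed any constant for suitable
  \<open>i\<close> and \<open>N\<close>.\<close>

lemma growing_sets_imp_not_abs_cesaro_bounded:
  assumes lc: "locally_compact_space (euclidean :: 'a topology)" and "growing_sets B"
  shows "\<not> abs_cesaro_bounded_in (small_support_space w f) T"
proof
  assume "abs_cesaro_bounded_in (small_support_space w f) T"
  then obtain C where C: "C > 0"
    "\<And>\<phi> N. \<phi> \<in> small_support_space w f \<Longrightarrow> N \<ge> 1 \<Longrightarrow> orbit_mean T \<phi> N \<le> C * norm \<phi>"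
    unfolding abs_cesaro_bounded_in_iff by blast
  have B: "rel_compact_open (B i)" "closure (B i) \<subseteq> B (Suc i)"
    "liminf (\<lambda>N. ereal (weight_mean w f (B i) N)) = 0" for i
    using assms(2) unfolding growing_sets_def by blast+
  obtain i N where N: "N \<ge> 1" "C < weight_mean w f (B i) N"
    using assms(2) unfolding growing_sets_def SUP_weight_mean_eq_infinity_iff by blast
  have "compact (closure (B i))"
    using B(1) by (simp add: rel_compact_open_def)
  then obtain \<phi> :: "'a \<Rightarrow>\<^sub>C 'k" where \<phi>: "\<phi> \<in> C0" "norm \<phi> \<le> 1"
    "\<And>x. x \<in> closure (B i) \<Longrightarrow> apply_bcontfun \<phi> x = 1"
    "closure {x. apply_bcontfun \<phi> x \<noteq> 0} \<subseteq> B (Suc i)"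
    using Urysohn_bump[OF lc _ B(1,2)] by metis
  have "\<phi> \<in> small_support_space w f"
    using \<phi>(1,4) B(1,3) small_support_functions_subset unfolding small_support_functions_def by blast
  then have "orbit_mean T \<phi> N \<le> C"
    using C \<phi>(2) N(1) by (meson mult_left_le less_imp_le order_trans)
  moreover have "weight_mean w f (B i) N \<le> 1 / 1 * orbit_mean T \<phi> N"
    using \<phi>(3) closure_subset[of "B i"] by (intro weight_mean_le_orbit_mean) (auto simp: subset_iff)
  ultimately show False using N(2) by simp
qed

text \<open>Chaos excludes boundedness, failure of boundedness yields an irregular function, and
  such a function yields both chaos and growing sets; growing sets exclude boundedness
  again.\<close>

lemma chaotic_characterization:
  assumes "locally_compact_space (euclidean :: 'a topology)"
  shows "(mean_li_yorke_chaotic C0 T \<longleftrightarrow>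
      (\<exists>B. (\<forall>i. rel_compact_open (B i)) \<and>
        (\<forall>i. closure (B i) \<subseteq> B (Suc i)) \<and>
        (\<forall>i. liminf (\<lambda>N. ereal (weight_mean w f (B i) N)) = 0) \<and>
        (SUP (i, N) \<in> UNIV \<times> {1..}. ereal (weight_mean w f (B i) N)) = \<infinity>)) \<and>
    (mean_li_yorke_chaotic C0 T \<longleftrightarrow> \<not> abs_cesaro_bounded_in (small_support_space w f) T)"
  unfolding growing_sets_def[symmetric]
proof (intro conjI iffI)
  show "\<exists>B. growing_sets B" if "mean_li_yorke_chaotic C0 T"
    using not_abs_cesaro_bounded_imp_irregular[OF chaotic_imp_not_abs_cesaro_bounded[OF that]]
      irregular_imp_growing_sets by metis
  show chaotic: "mean_li_yorke_chaotic C0 T" if "\<not> abs_cesaro_bounded_in (small_support_space w f) T"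
    using not_abs_cesaro_bounded_imp_irregular[OF that] irregular_imp_chaotic by metis
  show "mean_li_yorke_chaotic C0 T" if "\<exists>B. growing_sets B"
    using that growing_sets_imp_not_abs_cesaro_bounded[OF assms] by (intro chaotic) blast
qed (rule chaotic_imp_not_abs_cesaro_bounded)

end

theorem theorem74:
  assumes "locally_compact_space (euclidean :: 'a::t2_space topology)"
  shows
    "(\<forall>(w :: 'a \<Rightarrow> real) f. weight_map_pair w f \<longrightarrow>
        (mean_li_yorke_chaotic C0 (weighted_comp w f) \<longleftrightarrow>
         (\<exists>B :: nat \<Rightarrow> 'a set.
            (\<forall>i. rel_compact_open (B i)) \<and>
            (\<forall>i. closure (B i) \<subseteq> B (Suc i)) \<and>
            (\<forall>i. liminf (\<lambda>N. ereal (weight_mean w f (B i) N)) = 0) \<and>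
            (SUP (i, N) \<in> UNIV \<times> {1..}. ereal (weight_mean w f (B i) N)) = \<infinity>)) \<and>
        (mean_li_yorke_chaotic C0 (weighted_comp w f) \<longleftrightarrow>
         \<not> abs_cesaro_bounded_in (small_support_space w f) (weighted_comp w f))) \<and>
     (\<forall>(w :: 'a \<Rightarrow> complex) f. weight_map_pair w f \<longrightarrow>
        (mean_li_yorke_chaotic C0 (weighted_comp w f) \<longleftrightarrow>
         (\<exists>B :: nat \<Rightarrow> 'a set.
            (\<forall>i. rel_compact_open (B i)) \<and>
            (\<forall>i. closure (B i) \<subseteq> B (Suc i)) \<and>
            (\<forall>i. liminf (\<lambda>N. ereal (weight_mean w f (B i) N)) = 0) \<and>
            (SUP (i, N) \<in> UNIV \<times> {1..}. ereal (weight_mean w f (B i) N)) = \<infinity>)) \<and>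
        (mean_li_yorke_chaotic C0 (weighted_comp w f) \<longleftrightarrow>
         \<not> abs_cesaro_bounded_in (small_support_space w f) (weighted_comp w f)))"
  by (rule conjI; intro allI impI;
      rule weighted_composition.chaotic_characterization[OF weighted_composition.intro assms])

end
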